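(* Let $\mathcal{T}$ be a group of transformations acting on $X$ and on $Y$, let $P(t)$ be a uniform distribution over the group elements $t\in\mathcal{T}$, and let $f: X\to Y$ be an arbitrary function. Define the equivariant average of $f$ by $$\bar f(x) = \mathbb{E}_{t\sim P(t)}\left[\, t^{-1}\circ f\circ t(x)\,\right].$$ Then the averaged function $\bar f$ is equivariant to $\mathcal{T}$, that is, for any $t\in\mathcal{T}$, $$\bar f\circ t(x) = t\circ \bar f(x).$$
   Context: The same group $\mathcal{T}$ acts on both the input domain $X$ and the output domain $Y$, and the same symbol $t$ denotes the transformation on either domain. Thus $t^{-1}\circ f\circ t(x)$ means: transform the input $x\in X$ by $t$, apply $f$, then transform the resulting output in $Y$ by $t^{-1}$. A function $f: X\to Y$ is called equivariant to $\mathcal{T}$ if for any $t\in\mathcal{T}$ one has $f\circ t(x) = t\circ f(x)$, i.e. $t$ commutes with $f$. The symbol $\mathbb{E}_{t\sim P(t)}$ denotes expectation over $t$ drawn from $P(t)$. (In the motivating example, $x$ is an image, $t$ is a crop-and-resize transform, and $f$ is a dense predictor whose output is an image.)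
   Formalization: Y is taken to be a separable Banach space on which each t acts by a bounded linear map, since the claim fails for nonlinear actions on Y; the uniform distribution P(t) is read as a translation-invariant probability measure on the group. *)

theory Defs
  imports "HOL-Probability.Probability" "HOL-Algebra.Group_Action"
begin

(* On a general group, "uniform" is read as invariance under all translations; for a compact
   group this is the normalised Haar measure, and for a finite group the usual uniform
   distribution, as shown next. *)
definition uniform_on_group :: "('g, 'm) monoid_scheme \<Rightarrow> 'g measure \<Rightarrow> bool" where
  "uniform_on_group G P \<longleftrightarrow>
     prob_space P \<and> space P = carrier G \<and>
     (\<forall>g \<in> carrier G.
        (\<lambda>t. g \<otimes>\<^bsub>G\<^esub> t) \<in> measurable P P \<and> distr P P (\<lambda>t. g \<otimes>\<^bsub>G\<^esub> t) = P \<and>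
        (\<lambda>t. t \<otimes>\<^bsub>G\<^esub> g) \<in> measurable P P \<and> distr P P (\<lambda>t. t \<otimes>\<^bsub>G\<^esub> g) = P)"

lemma uniform_on_finite_group:
  fixes G (structure)
  assumes "group G" and fin: "finite (carrier G)" and sets: "sets P = Pow (carrier G)"
  shows "uniform_on_group G P \<longleftrightarrow> P = uniform_count_measure (carrier G)"
proof
  interpret group G by fact
  have ne: "carrier G \<noteq> {}" by auto
  have spc: "space P = carrier G" using sets sets_eq_imp_space_eq[of P "count_space (carrier G)"] by simp
  {
    assume U: "uniform_on_group G P"
    then interpret P: prob_space P by (simp add: uniform_on_group_def)
    have eq: "emeasure P {g} = emeasure P {\<one>}" if g: "g \<in> carrier G" for g
    proof -
      have m: "(\<lambda>t. g \<otimes> t) \<in> measurable P P" and d: "distr P P (\<lambda>t. g \<otimes> t) = P"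
        using U g by (auto simp: uniform_on_group_def)
      have "emeasure P {g} = emeasure (distr P P (\<lambda>t. g \<otimes> t)) {g}" using d by simp
      also have "\<dots> = emeasure P ((\<lambda>t. g \<otimes> t) -` {g} \<inter> space P)"
        using m g sets by (intro emeasure_distr) auto
      also have "(\<lambda>t. g \<otimes> t) -` {g} \<inter> space P = {\<one>}" using g spc by auto
      finally show ?thesis .
    qed
    have c: "card (carrier G) > 0" using fin ne by (simp add: card_gt_0_iff)
    have "1 = measure P (carrier G)" using P.prob_space spc by simp
    also have "\<dots> = (\<Sum>g\<in>carrier G. measure P {g})"
      using fin sets by (intro P.finite_measure_eq_sum_singleton) auto
    also have "\<dots> = (\<Sum>g\<in>carrier G. measure P {\<one>})"
      unfolding measure_def by (intro sum.cong refl arg_cong[where f = enn2real] eq)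
    also have "\<dots> = real (card (carrier G)) * measure P {\<one>}" by simp
    finally have "measure P {\<one>} = 1 / real (card (carrier G))"
      using c by (simp add: field_simps)
    then have e1: "emeasure P {\<one>} = ennreal (1 / real (card (carrier G)))"
      by (simp add: P.emeasure_eq_measure)
    show "P = uniform_count_measure (carrier G)"
    proof (rule measure_eqI_finite)
      show "sets P = Pow (carrier G)" "sets (uniform_count_measure (carrier G)) = Pow (carrier G)"
        "finite (carrier G)" using sets fin by (simp_all add: sets_uniform_count_measure)
      fix g assume g: "g \<in> carrier G"
      show "emeasure P {g} = emeasure (uniform_count_measure (carrier G)) {g}"
        unfolding eq[OF g] e1 using g fin by (simp add: emeasure_uniform_count_measure)
    qed
  next
    assume P: "P = uniform_count_measure (carrier G)"
    have pr: "prob_space P" unfolding P by (rule prob_space_uniform_count_measure) (use fin ne in auto)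
    have inv: "distr P P h = P" if h: "bij_betw h (carrier G) (carrier G)" for h
    proof (rule measure_eqI_finite)
      show "sets (distr P P h) = Pow (carrier G)" "sets P = Pow (carrier G)"
        "finite (carrier G)" using sets fin by auto
      fix g assume g: "g \<in> carrier G"
      then have "g \<in> h ` carrier G" using bij_betw_imp_surj_on[OF h] by simp
      then obtain k where k: "k \<in> carrier G" "h k = g" by (elim imageE) simp
      have v: "h -` {g} \<inter> carrier G = {k}"
        using k inj_on_eq_iff[OF bij_betw_imp_inj_on[OF h]] by auto
      have m: "h \<in> measurable P P"
        using bij_betw_imp_funcset[OF h] sets spc by (auto simp: measurable_def)
      have single: "emeasure P {a} = ennreal (1 / real (card (carrier G)))" if "a \<in> carrier G" for a
        using that fin unfolding P by (subst emeasure_uniform_count_measure) simp_all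
      have "emeasure (distr P P h) {g} = emeasure P (h -` {g} \<inter> carrier G)"
        using emeasure_distr[OF m, of "{g}"] g sets spc by simp
      then show "emeasure (distr P P h) {g} = emeasure P {g}"
        using g k(1) by (simp add: v single)
    qed
    have L: "bij_betw (\<lambda>t. g \<otimes> t) (carrier G) (carrier G)"
     and R: "bij_betw (\<lambda>t. t \<otimes> g) (carrier G) (carrier G)" if g: "g \<in> carrier G" for g
    proof -
      show "bij_betw (\<lambda>t. g \<otimes> t) (carrier G) (carrier G)"
        using g by (simp add: bij_betw_def inj_on_cmult surj_const_mult)
      show "bij_betw (\<lambda>t. t \<otimes> g) (carrier G) (carrier G)"
        using g by (intro bij_betw_byWitness[where f' = "\<lambda>t. t \<otimes> inv g"]) (auto simp: m_assoc)
    qed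
    show "uniform_on_group G P"
      unfolding uniform_on_group_def
    proof (intro conjI ballI)
      fix g assume g: "g \<in> carrier G"
      show "(\<lambda>t. g \<otimes> t) \<in> measurable P P" "(\<lambda>t. t \<otimes> g) \<in> measurable P P"
        using g sets spc by (auto simp: measurable_def)
      show "distr P P (\<lambda>t. g \<otimes> t) = P" "distr P P (\<lambda>t. t \<otimes> g) = P"
        using inv[OF L[OF g]] inv[OF R[OF g]] .
    qed (rule pr spc)+
  }
qed

(* \<phi> and \<psi> are the actions of the same group on the input and on the output domain. *)
definition equivariant ::
    "('g, 'm) monoid_scheme \<Rightarrow> 'x set \<Rightarrow> ('g \<Rightarrow> 'x \<Rightarrow> 'x) \<Rightarrow> ('g \<Rightarrow> 'y \<Rightarrow> 'y) \<Rightarrow> ('x \<Rightarrow> 'y) \<Rightarrow> bool" where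
  "equivariant G X \<phi> \<psi> f \<longleftrightarrow> (\<forall>t \<in> carrier G. \<forall>x \<in> X. f (\<phi> t x) = \<psi> t (f x))"

(* The expectation is a Bochner integral over t; where the integrand is not integrable, the
   library gives it the value 0. *)
definition equivariant_average ::
    "('g, 'm) monoid_scheme \<Rightarrow> 'g measure \<Rightarrow> ('g \<Rightarrow> 'x \<Rightarrow> 'x) \<Rightarrow> ('g \<Rightarrow> 'y \<Rightarrow> 'y)
      \<Rightarrow> ('x \<Rightarrow> 'y) \<Rightarrow> 'x \<Rightarrow> 'y::{banach, second_countable_topology}" where
  "equivariant_average G P \<phi> \<psi> f x = (LINT t|P. \<psi> (inv\<^bsub>G\<^esub> t) (f (\<phi> t x)))"

end

theory Submission
  imports Defs
begin

text \<open>
  Put h(t) = inv(t) f(t x). The integrand of the average at s x is t \<mapsto> s h(t s): the linear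
  map s comes out of the integral, and invariance of P under right translation by s
  removes the s inside h.
\<close>

text \<open>A translation has a measurable inverse, so h and its translate are measurable together;
  if neither is, both integrals have the junk value 0.\<close>

lemma integral_right_translate:
  fixes h :: "'g \<Rightarrow> 'y::{banach, second_countable_topology}"
  assumes "group G" and U: "uniform_on_group G P" and s: "s \<in> carrier G"
  shows "(LINT t|P. h (t \<otimes>\<^bsub>G\<^esub> s)) = (LINT t|P. h t)"
proof -
  interpret group G by fact
  have sp: "space P = carrier G"
    and meas: "\<And>g. g \<in> carrier G \<Longrightarrow> (\<lambda>t. t \<otimes>\<^bsub>G\<^esub> g) \<in> measurable P P"
    and inv: "distr P P (\<lambda>t. t \<otimes>\<^bsub>G\<^esub> s) = P"
    using U s by (auto simp: uniform_on_group_def)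
  show ?thesis
  \<comment> \<open>Nothing makes \<open>h\<close> measurable here, and
    \<open>integral_distr\<close> requires it.\<close>
  proof (cases "h \<in> borel_measurable P")
    case True
    then show ?thesis
      using integral_distr[OF meas[OF s], of h] inv by simp
  next
    case False
    have "(\<lambda>t. h (t \<otimes>\<^bsub>G\<^esub> s)) \<notin> borel_measurable P"
    proof
      assume "(\<lambda>t. h (t \<otimes>\<^bsub>G\<^esub> s)) \<in> borel_measurable P"
      then have "(\<lambda>t. h (t \<otimes>\<^bsub>G\<^esub> inv\<^bsub>G\<^esub> s \<otimes>\<^bsub>G\<^esub> s)) \<in> borel_measurable P"
        by (rule measurable_compose[OF meas[OF inv_closed[OF s]]])
      \<comment> \<open>The two functions need to agree only on \<open>space P\<close>, that is on
        the carrier, where the group laws cancel \<open>s\<close>.\<close>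
      also have "?this \<longleftrightarrow> h \<in> borel_measurable P"
        using s by (intro measurable_cong) (simp add: sp m_assoc)
      finally show False using False by contradiction
    qed
    with False show ?thesis
      by (metis borel_measurable_integrable not_integrable_integral_eq)
  qed
qed

theorem proposition1:
  fixes G :: "('g, 'm) monoid_scheme"
    and P :: "'g measure"
    and X :: "'x set"
    and \<phi> :: "'g \<Rightarrow> 'x \<Rightarrow> 'x"
    and \<psi> :: "'g \<Rightarrow> 'y \<Rightarrow> 'y::{banach, second_countable_topology}"
    and f :: "'x \<Rightarrow> 'y"
  assumes "group G"
    and "group_action G X \<phi>"
    and "group_action G UNIV \<psi>"
    and "\<And>t. t \<in> carrier G \<Longrightarrow> bounded_linear (\<psi> t)"
    and "uniform_on_group G P"
  shows "equivariant G X \<phi> \<psi> (equivariant_average G P \<phi> \<psi> f)"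
proof -
  interpret group G by fact
  interpret \<phi>: group_action G X \<phi> by fact
  interpret \<psi>: group_action G UNIV \<psi> by fact
  have sp: "space P = carrier G"
    using assms(5) by (simp add: uniform_on_group_def)
  show ?thesis
    unfolding equivariant_def
  proof (intro ballI)
    fix s x assume s: "s \<in> carrier G" and x: "x \<in> X"
    define h where "h t = \<psi> (inv\<^bsub>G\<^esub> t) (f (\<phi> t x))" for t
    have integrand: "\<psi> (inv\<^bsub>G\<^esub> t) (f (\<phi> t (\<phi> s x))) = \<psi> s (h (t \<otimes>\<^bsub>G\<^esub> s))"
      if t: "t \<in> carrier G" for t
    proof -
      \<comment> \<open>This pulls the factor \<open>\<psi> s\<close> to the front, independent of
        \<open>t\<close>; what remains is \<open>h\<close> at the product of \<open>t\<close> and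
        \<open>s\<close>, since \<open>\<phi> t (\<phi> s x)\<close> is the action of that product
        on \<open>x\<close>.\<close>
      have "inv\<^bsub>G\<^esub> t = s \<otimes>\<^bsub>G\<^esub> inv\<^bsub>G\<^esub> (t \<otimes>\<^bsub>G\<^esub> s)"
        using s t by (simp add: inv_mult_group flip: m_assoc)
      then show ?thesis
        using s t x by (simp add: h_def \<psi>.composition_rule \<phi>.composition_rule)
    qed
    \<comment> \<open>A bounded linear left inverse of \<open>\<psi> s\<close> lets
      \<open>\<psi> s\<close> leave the integral without integrability of \<open>h\<close>: if the
      integrand is not integrable before applying \<open>\<psi> s\<close>, it is not afterwards, and
      both sides are 0.\<close>
    have cancel: "\<psi> (inv\<^bsub>G\<^esub> s) (\<psi> s y) = y" for y
      using s \<psi>.composition_rule[of y "inv\<^bsub>G\<^esub> s" s] \<psi>.id_eq_one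
      by (metis UNIV_I inv_closed l_inv restrict_apply')
    have "equivariant_average G P \<phi> \<psi> f (\<phi> s x) = (LINT t|P. \<psi> s (h (t \<otimes>\<^bsub>G\<^esub> s)))"
      unfolding equivariant_average_def
      by (intro Bochner_Integration.integral_cong refl) (simp add: sp integrand)
    also have "\<dots> = \<psi> s (LINT t|P. h (t \<otimes>\<^bsub>G\<^esub> s))"
      using s cancel by (intro integral_bounded_linear'[of _ "\<psi> (inv\<^bsub>G\<^esub> s)"] assms(4)) auto
    also have "(LINT t|P. h (t \<otimes>\<^bsub>G\<^esub> s)) = (LINT t|P. h t)"
      using assms(1,5) s by (rule integral_right_translate)
    finally show "equivariant_average G P \<phi> \<psi> f (\<phi> s x) = \<psi> s (equivariant_average G P \<phi> \<psi> f x)"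
      by (simp add: equivariant_average_def h_def)
  qed
qed

end
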